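(* Let $F_2$ be the free group on two generators. Let $C(F_2)$ be the category whose objects are the injective group morphisms $\phi_H:F_2\to H$, and let $D$ be the class of objects $\phi_H:F_2\to H$ of $C(F_2)$ such that $H$ is a free group. Then the couple $(C(F_2),D)$ is a Top couple.
   Context: A morphism $(H,\phi_H)\to(H',\phi_{H'})$ in $C(F_2)$ is a group morphism $f:H\to H'$ with $f\circ\phi_H=\phi_{H'}$. An ideal of an object $(H,\phi_H)$ of $C(F_2)$ is a normal subgroup $I$ of $H$ such that $I\cap\phi_H(F_2)=\{1\}$ (equivalently, $H/I$ with the induced map from $F_2$ is an object of $C(F_2)$). For elements $a,b$ of a group, $[a,b]=aba^{-1}b^{-1}$; for subgroups $U,V$ of a group $H$, $[U,V]$ is the normal subgroup of $H$ generated by all $[u,v]$, $u\in U$, $v\in V$; $1$ also denotes the trivial subgroup. A couple $(C,D)$, where $C$ is a category of groups (here $C=C(F_2)$, whose objects are the groups $H$ equipped with an injective group morphism $\phi_H:F_2\to H$ and whose morphisms are the group morphisms $f:H\to H'$ with $f\circ\phi_H=\phi_{H'}$; in general, an ideal of an object $H$ of $C$ is a normal subgroup $I$ of $H$ such that $H/I$ is an object of $C$ and the projection $H\to H/I$ is a morphism of $C$) and $D$ is a subclass of its objects, is called a Top couple if: (T1) if $L$ is an object of $C$, $L'\in D$, and there is an injective $C$-morphism $L\to L'$, then $L\in D$; (T2) if $L\in D$ and $I,J$ are normal subgroups of $L$ with $[I,J]=1$, then $I=1$ or $J=1$; (T3) the inverse image of an ideal by a morphism of $C$ is an ideal. *)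

theory Defs
  imports "HOL-Algebra.Weak_Morphisms"
begin

section \<open>Free groups\<close>

text \<open>The free group on a set \<open>X\<close> is the group of reduced words over \<open>X\<close>; the letter
  \<open>(x, True)\<close> stands for the generator \<open>x\<close> and \<open>(x, False)\<close> for its inverse.\<close>

type_synonym 'x letter = "'x \<times> bool"

definition inv_letter :: "'x letter \<Rightarrow> 'x letter" where
  "inv_letter a = (fst a, \<not> snd a)"

definition reduced :: "'x letter list \<Rightarrow> bool" where
  "reduced w \<longleftrightarrow> successively (\<lambda>a b. b \<noteq> inv_letter a) w"

fun reduced_Cons :: "'x letter \<Rightarrow> 'x letter list \<Rightarrow> 'x letter list" where
  "reduced_Cons a [] = [a]"
| "reduced_Cons a (b # w) = (if b = inv_letter a then w else a # b # w)"

definition free_group :: "'x set \<Rightarrow> 'x letter list monoid" where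
  "free_group X = \<lparr>carrier = {w. reduced w \<and> fst ` set w \<subseteq> X},
     mult = foldr reduced_Cons, one = []\<rparr>"

text \<open>A basis of a group is a subset of its carrier, so no generality is lost by taking the
  generating set \<open>X\<close> in the type of the group elements.\<close>

definition is_free_group :: "('a, 'm) monoid_scheme \<Rightarrow> bool" where
  "is_free_group G \<longleftrightarrow> group G \<and> (\<exists>X :: 'a set. free_group X \<cong> G)"

lemma inv_letter_inv_letter [simp]: "inv_letter (inv_letter a) = a"
  by (simp add: inv_letter_def)

lemma fst_inv_letter [simp]: "fst (inv_letter a) = fst a"
  by (simp add: inv_letter_def)

lemma reduced_Nil [simp]: "reduced []"
  by (simp add: reduced_def)

lemma reduced_ConsD: "reduced (a # w) \<Longrightarrow> reduced w"
  by (cases w) (simp_all add: reduced_def)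

lemma reduced_Cons_Cons:
  "reduced (a # b # w) \<longleftrightarrow> b \<noteq> inv_letter a \<and> reduced (b # w)"
  by (simp add: reduced_def)

lemma reduced_reduced_Cons:
  assumes "reduced w"
  shows "reduced (reduced_Cons a w)"
proof (cases w)
  case Nil
  then show ?thesis
    by (simp add: reduced_def)
next
  case (Cons b v)
  show ?thesis
  proof (cases "b = inv_letter a")
    case True
    then show ?thesis
      using assms reduced_ConsD[of b v] Cons by simp
  next
    case False
    then show ?thesis
      using assms Cons by (simp add: reduced_Cons_Cons)
  qed
qed

lemma reduced_foldr: "reduced w \<Longrightarrow> reduced (foldr reduced_Cons u w)"
  by (induction u) (simp_all add: reduced_reduced_Cons)

lemma set_reduced_Cons: "fst ` set (reduced_Cons a w) \<subseteq> insert (fst a) (fst ` set w)"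
proof (cases w)
  case (Cons b v)
  then show ?thesis
    by (cases "b = inv_letter a") (simp_all add: subset_insertI2 subset_insertI)
qed simp

lemma set_foldr_reduced_Cons:
  "fst ` set (foldr reduced_Cons u w) \<subseteq> fst ` set u \<union> fst ` set w"
proof (induction u)
  case (Cons a u)
  have "fst ` set (foldr reduced_Cons (a # u) w)
      \<subseteq> insert (fst a) (fst ` set (foldr reduced_Cons u w))"
    using set_reduced_Cons[of a "foldr reduced_Cons u w"] by simp
  also have "\<dots> \<subseteq> insert (fst a) (fst ` set u \<union> fst ` set w)"
    using Cons by (rule insert_mono)
  finally show ?case
    by simp
qed simp

lemma reduced_Cons_reduced: "reduced (a # w) \<Longrightarrow> reduced_Cons a w = a # w"
  by (cases w) (simp_all add: reduced_Cons_Cons)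

lemma reduced_Cons_cancel:
  assumes "reduced w"
  shows "reduced_Cons a (reduced_Cons (inv_letter a) w) = w"
proof (cases w)
  case (Cons b v)
  then show ?thesis
    using assms reduced_Cons_reduced[of a v] by auto
qed simp

lemma foldr_reduced_Cons_reduced_Cons:
  assumes "reduced w"
  shows "foldr reduced_Cons (reduced_Cons a v) w = reduced_Cons a (foldr reduced_Cons v w)"
proof (cases v)
  case (Cons b u)
  then show ?thesis
    using reduced_Cons_cancel[OF reduced_foldr[OF assms]] by auto
qed simp

lemma foldr_reduced_Cons_assoc:
  assumes "reduced w"
  shows "foldr reduced_Cons (foldr reduced_Cons u v) w
       = foldr reduced_Cons u (foldr reduced_Cons v w)"
  by (induction u) (simp_all add: foldr_reduced_Cons_reduced_Cons assms)

lemma foldr_reduced_Cons_Nil: "reduced u \<Longrightarrow> foldr reduced_Cons u [] = u"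
proof (induction u)
  case (Cons a u)
  then show ?case
    using reduced_ConsD[of a u] reduced_Cons_reduced[of a u] by simp
qed simp

lemma foldr_reduced_Cons_inverse:
  assumes "reduced w"
  shows "foldr reduced_Cons (rev (map inv_letter u)) (foldr reduced_Cons u w) = w"
  using assms
proof (induction u arbitrary: w)
  case (Cons a u)
  have "reduced_Cons (inv_letter a) (reduced_Cons a (foldr reduced_Cons u w))
      = foldr reduced_Cons u w"
    using reduced_Cons_cancel[OF reduced_foldr[OF Cons.prems], of "inv_letter a" u] by simp
  then show ?case
    using Cons by simp
qed simp

lemma group_free_group: "group (free_group X)"
proof (rule groupI)
  fix u v assume uv: "u \<in> carrier (free_group X)" "v \<in> carrier (free_group X)"
  then have "fst ` set u \<union> fst ` set v \<subseteq> X"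
    by (simp add: free_group_def)
  then show "u \<otimes>\<^bsub>free_group X\<^esub> v \<in> carrier (free_group X)"
    using uv order_trans[OF set_foldr_reduced_Cons[of u v]]
    by (simp add: free_group_def reduced_foldr)
next
  fix u assume u: "u \<in> carrier (free_group X)"
  let ?v = "foldr reduced_Cons (rev (map inv_letter u)) []"
  have "?v \<in> carrier (free_group X)"
    using u order_trans[OF set_foldr_reduced_Cons[of "rev (map inv_letter u)" "[]"], of X]
    by (simp add: free_group_def reduced_foldr image_image)
  moreover have "foldr reduced_Cons ?v u = []"
    using u foldr_reduced_Cons_assoc[of u "rev (map inv_letter u)" "[]"]
      foldr_reduced_Cons_inverse[of "[]" u] foldr_reduced_Cons_Nil[of u]
    by (simp add: free_group_def)
  ultimately show "\<exists>v\<in>carrier (free_group X). v \<otimes>\<^bsub>free_group X\<^esub> u = \<one>\<^bsub>free_group X\<^esub>"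
    by (auto simp: free_group_def)
qed (auto simp: free_group_def foldr_reduced_Cons_assoc)


section \<open>Top couples\<close>

text \<open>Categories of groups whose underlying groups have carriers in an arbitrary type \<open>'u\<close>, which
  plays the role of the universe. Objects may carry additional structure, hence the type \<open>'o\<close>.
  Morphisms are represented by functions \<open>'u \<Rightarrow> 'u\<close> of which only the values on the carrier
  of the source are relevant.\<close>

record ('o, 'u) group_category =
  objects :: "'o set"
  grp :: "'o \<Rightarrow> 'u monoid"
  mor :: "'o \<Rightarrow> 'o \<Rightarrow> ('u \<Rightarrow> 'u) set"

definition is_group_category :: "('o, 'u) group_category \<Rightarrow> bool" where
  "is_group_category C \<longleftrightarrow>
     (\<forall>L\<in>objects C. group (grp C L)) \<and>
     (\<forall>L\<in>objects C. \<forall>M\<in>objects C. mor C L M \<subseteq> hom (grp C L) (grp C M)) \<and>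
     (\<forall>L\<in>objects C. (\<lambda>x. x) \<in> mor C L L) \<and>
     (\<forall>L\<in>objects C. \<forall>M\<in>objects C. \<forall>N\<in>objects C.
        \<forall>f\<in>mor C L M. \<forall>g\<in>mor C M N. g \<circ> f \<in> mor C L N)"

text \<open>An ideal of \<open>L\<close> is a normal subgroup \<open>I\<close> such that \<open>L/I\<close> is an object and the projection
  \<open>L \<rightarrow> L/I\<close> is a morphism. The library's quotient \<open>grp C L Mod I\<close> has its carrier in
  \<open>'u set\<close>, so it is an object of the category only through an isomorphic copy in \<open>'u\<close>.
  Lemmas \<open>group_ideal_cat_F2_iff\<close> and \<open>group_ideal_cat_F2_iff_Mod\<close> below describe the ideals in
  the case of interest without such copies.\<close>

definition group_ideal :: "('o, 'u) group_category \<Rightarrow> 'o \<Rightarrow> 'u set \<Rightarrow> bool" where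
  "group_ideal C L I \<longleftrightarrow> I \<lhd> grp C L \<and>
     (\<exists>Q\<in>objects C. \<exists>h\<in>iso (grp C L Mod I) (grp C Q).
        (\<lambda>x. h (I #>\<^bsub>grp C L\<^esub> x)) \<in> mor C L Q)"

definition commutator_subgroup :: "('a, 'm) monoid_scheme \<Rightarrow> 'a set \<Rightarrow> 'a set \<Rightarrow> 'a set" where
  "commutator_subgroup G U V = \<Inter>{N. N \<lhd> G \<and>
     (\<forall>u\<in>U. \<forall>v\<in>V. u \<otimes>\<^bsub>G\<^esub> v \<otimes>\<^bsub>G\<^esub> inv\<^bsub>G\<^esub> u \<otimes>\<^bsub>G\<^esub> inv\<^bsub>G\<^esub> v \<in> N)}"

definition top_couple :: "('o, 'u) group_category \<Rightarrow> 'o set \<Rightarrow> bool" where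
  "top_couple C D \<longleftrightarrow> is_group_category C \<and> D \<subseteq> objects C \<and>
     (\<forall>L\<in>objects C. \<forall>L'\<in>D.
        (\<exists>f\<in>mor C L L'. inj_on f (carrier (grp C L))) \<longrightarrow> L \<in> D) \<and>
     (\<forall>L\<in>D. \<forall>I J. I \<lhd> grp C L \<and> J \<lhd> grp C L \<and>
        commutator_subgroup (grp C L) I J = {\<one>\<^bsub>grp C L\<^esub>} \<longrightarrow>
        I = {\<one>\<^bsub>grp C L\<^esub>} \<or> J = {\<one>\<^bsub>grp C L\<^esub>}) \<and>
     (\<forall>L\<in>objects C. \<forall>M\<in>objects C. \<forall>f\<in>mor C L M. \<forall>I.
        group_ideal C M I \<longrightarrow> group_ideal C L {x \<in> carrier (grp C L). f x \<in> I})"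


section \<open>Groups under the free group on two generators\<close>

definition F2 :: "bool letter list monoid" where
  "F2 = free_group UNIV"

type_synonym 'u F2_group = "'u monoid \<times> (bool letter list \<Rightarrow> 'u)"

definition is_F2_group :: "'u F2_group \<Rightarrow> bool" where
  "is_F2_group L \<longleftrightarrow>
     group (fst L) \<and> snd L \<in> hom F2 (fst L) \<and> inj_on (snd L) (carrier F2)"

definition F2_hom :: "'u F2_group \<Rightarrow> 'v F2_group \<Rightarrow> ('u \<Rightarrow> 'v) set" where
  "F2_hom L M = {f \<in> hom (fst L) (fst M). \<forall>w\<in>carrier F2. f (snd L w) = snd M w}"

definition cat_F2 :: "('u F2_group, 'u) group_category" where
  "cat_F2 = \<lparr>objects = {L. is_F2_group L}, grp = fst, mor = F2_hom\<rparr>"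

definition free_F2_groups :: "'u F2_group set" where
  "free_F2_groups = {L. is_F2_group L \<and> is_free_group (fst L)}"

lemma group_F2: "group F2"
  unfolding F2_def by (rule group_free_group)

lemma is_F2_group_Mod_iff:
  assumes L: "is_F2_group L" and I: "I \<lhd> fst L"
  shows "is_F2_group (fst L Mod I, \<lambda>w. I #>\<^bsub>fst L\<^esub> snd L w)
     \<longleftrightarrow> I \<inter> snd L ` carrier F2 = {\<one>\<^bsub>fst L\<^esub>}"
proof -
  obtain G \<phi> where LG: "L = (G, \<phi>)" by (cases L)
  have G: "group G" and \<phi>: "\<phi> \<in> hom F2 G" and inj: "inj_on \<phi> (carrier F2)" and N: "I \<lhd> G"
    using L I by (auto simp: LG is_F2_group_def)
  interpret G: group G by (rule G)
  interpret N: normal I G by (rule N)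
  interpret F: group F2 by (rule group_F2)
  interpret p: group_hom F2 G \<phi>
    by unfold_locales (rule \<phi>)
  have \<psi>: "(\<lambda>w. I #>\<^bsub>G\<^esub> \<phi> w) \<in> hom F2 (G Mod I)"
    using Group.hom_compose[OF \<phi> N.r_coset_hom_Mod] by (simp add: comp_def)
  interpret q: group_hom F2 "G Mod I" "\<lambda>w. I #>\<^bsub>G\<^esub> \<phi> w"
    by (intro group_hom.intro group_hom_axioms.intro F.is_group N.factorgroup_is_group \<psi>)
  have ker: "w \<in> kernel F2 (G Mod I) (\<lambda>w. I #>\<^bsub>G\<^esub> \<phi> w) \<longleftrightarrow> w \<in> carrier F2 \<and> \<phi> w \<in> I" for w
    using N.rcos_const[OF G] G.rcos_self[OF p.hom_closed N.is_subgroup, of w]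
    by (auto simp: kernel_def FactGroup_def)
  have "inj_on (\<lambda>w. I #>\<^bsub>G\<^esub> \<phi> w) (carrier F2) \<longleftrightarrow> {w \<in> carrier F2. \<phi> w \<in> I} = {\<one>\<^bsub>F2\<^esub>}"
    unfolding q.inj_iff_trivial_ker using ker by blast
  also have "\<dots> \<longleftrightarrow> I \<inter> \<phi> ` carrier F2 = {\<one>\<^bsub>G\<^esub>}"
  proof
    assume *: "{w \<in> carrier F2. \<phi> w \<in> I} = {\<one>\<^bsub>F2\<^esub>}"
    have "x = \<one>\<^bsub>G\<^esub>" if x: "x \<in> I \<inter> \<phi> ` carrier F2" for x
    proof -
      obtain w where w: "w \<in> carrier F2" "x = \<phi> w"
        using x by blast
      then have "w \<in> {w \<in> carrier F2. \<phi> w \<in> I}"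
        using x by simp
      then have "w = \<one>\<^bsub>F2\<^esub>"
        unfolding * by simp
      then show ?thesis
        using w p.hom_one by simp
    qed
    moreover have "\<one>\<^bsub>G\<^esub> \<in> I \<inter> \<phi> ` carrier F2"
      using imageI[OF F.one_closed, of \<phi>] by simp
    ultimately show "I \<inter> \<phi> ` carrier F2 = {\<one>\<^bsub>G\<^esub>}"
      by blast
  next
    assume *: "I \<inter> \<phi> ` carrier F2 = {\<one>\<^bsub>G\<^esub>}"
    have "w = \<one>\<^bsub>F2\<^esub>" if w: "w \<in> carrier F2" "\<phi> w \<in> I" for w
    proof -
      have "\<phi> w \<in> I \<inter> \<phi> ` carrier F2"
        using w by blast
      then have "\<phi> w = \<phi> \<one>\<^bsub>F2\<^esub>"
        unfolding * by simp
      then show ?thesis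
        using inj_onD[OF inj] w F.one_closed by simp
    qed
    then show "{w \<in> carrier F2. \<phi> w \<in> I} = {\<one>\<^bsub>F2\<^esub>}"
      using p.hom_one by auto
  qed
  finally show ?thesis
    using N.factorgroup_is_group \<psi> by (simp add: is_F2_group_def LG)
qed

lemma group_ideal_cat_F2_iff_Mod:
  fixes L :: "'a F2_group"
  assumes L: "is_F2_group L"
  shows "group_ideal cat_F2 L I \<longleftrightarrow>
     I \<lhd> fst L \<and> is_F2_group (fst L Mod I, \<lambda>w. I #>\<^bsub>fst L\<^esub> snd L w)"
proof (cases "I \<lhd> fst L")
  case N: True
  obtain G \<phi> where LG: "L = (G, \<phi>)" by (cases L)
  have G: "group G" and \<phi>: "\<phi> \<in> hom F2 G" and NG: "I \<lhd> G"
    using L N by (auto simp: LG is_F2_group_def)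
  interpret N: normal I G by (rule NG)
  let ?\<psi> = "\<lambda>w. I #>\<^bsub>G\<^esub> \<phi> w"
  have \<psi>: "?\<psi> \<in> hom F2 (G Mod I)"
    using Group.hom_compose[OF \<phi> N.r_coset_hom_Mod] by (simp add: comp_def)
  show ?thesis
  proof
    assume "group_ideal cat_F2 L I"
    then have "\<exists>(Q :: 'a F2_group) h. is_F2_group Q \<and> (\<forall>w\<in>carrier F2. h (?\<psi> w) = snd Q w)"
      by (simp add: group_ideal_def cat_F2_def F2_hom_def LG del: split_paired_Ex) blast
    then obtain Q :: "'a F2_group" and h where Q: "is_F2_group Q"
      and eq: "\<And>w. w \<in> carrier F2 \<Longrightarrow> h (?\<psi> w) = snd Q w"
      by blast
    have "inj_on ?\<psi> (carrier F2)"
    proof (rule inj_onI)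
      fix v w assume vw: "v \<in> carrier F2" "w \<in> carrier F2" "?\<psi> v = ?\<psi> w"
      then have "snd Q v = snd Q w"
        using eq by metis
      then show "v = w"
        using Q vw by (auto simp: is_F2_group_def dest: inj_onD)
    qed
    then show "I \<lhd> fst L \<and> is_F2_group (fst L Mod I, \<lambda>w. I #>\<^bsub>fst L\<^esub> snd L w)"
      using N \<psi> N.factorgroup_is_group by (simp add: is_F2_group_def LG)
  next
    assume *: "I \<lhd> fst L \<and> is_F2_group (fst L Mod I, \<lambda>w. I #>\<^bsub>fst L\<^esub> snd L w)"
    define r where "r A = (SOME x. x \<in> A)" for A :: "'a set"
    have r: "r A \<in> A" if "A \<in> carrier (G Mod I)" for A
    proof -
      have "A \<noteq> {}"
        using that N.rcosets_non_empty by (auto simp: FactGroup_def)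
      then show ?thesis
        unfolding r_def by (simp add: some_in_eq)
    qed
    have inj: "inj_on r (carrier (G Mod I))"
    proof (rule inj_onI)
      fix A B assume A: "A \<in> carrier (G Mod I)" and B: "B \<in> carrier (G Mod I)" and eq: "r A = r B"
      then have "A \<inter> B \<noteq> {}"
        using r[OF A] r[OF B] by auto
      then show "A = B"
        using A B N.rcos_disjoint[OF N.is_subgroup]
        by (auto simp: FactGroup_def pairwise_def disjnt_def)
    qed
    define K where "K = image_group r (G Mod I)"
    have h: "r \<in> iso (G Mod I) K"
      unfolding K_def by (rule inj_imp_image_group_iso[OF inj])
    have K: "group K"
      unfolding K_def by (rule group.inj_imp_image_group_is_group[OF N.factorgroup_is_group inj])
    have rh: "r \<in> hom (G Mod I) K"
      using h by (simp add: iso_def)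
    have "is_F2_group (K, \<lambda>w. r (?\<psi> w))"
    proof -
      have "(\<lambda>w. r (?\<psi> w)) \<in> hom F2 K"
        using Group.hom_compose[OF \<psi> rh] by (simp add: comp_def)
      moreover have "inj_on (\<lambda>w. r (?\<psi> w)) (carrier F2)"
        using comp_inj_on[of ?\<psi> "carrier F2" r] * inj_on_subset[OF inj] hom_carrier[OF \<psi>]
        by (simp add: is_F2_group_def LG comp_def)
      ultimately show ?thesis
        using K by (simp add: is_F2_group_def)
    qed
    moreover have "(\<lambda>x. r (I #>\<^bsub>G\<^esub> x)) \<in> hom G K"
      using Group.hom_compose[OF N.r_coset_hom_Mod rh] by (simp add: comp_def)
    ultimately have "(\<lambda>x. r (I #>\<^bsub>G\<^esub> x)) \<in> F2_hom L (K, \<lambda>w. r (?\<psi> w))"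
      and "(K, \<lambda>w. r (?\<psi> w)) \<in> objects cat_F2"
      by (simp_all add: F2_hom_def cat_F2_def LG)
    then show "group_ideal cat_F2 L I"
      unfolding group_ideal_def using N h
      by (intro conjI bexI[of _ "(K, \<lambda>w. r (?\<psi> w))"] bexI[of _ r]) (simp_all add: cat_F2_def LG)
  qed
qed (simp add: group_ideal_def cat_F2_def)

lemma group_ideal_cat_F2_iff:
  assumes "is_F2_group L"
  shows "group_ideal cat_F2 L I \<longleftrightarrow> I \<lhd> fst L \<and> I \<inter> snd L ` carrier F2 = {\<one>\<^bsub>fst L\<^esub>}"
  using group_ideal_cat_F2_iff_Mod[OF assms] is_F2_group_Mod_iff[OF assms] by blast

end

theory Submission
  imports Defs
begin

text \<open>Closure under subobjects is the Nielsen--Schreier theorem. For a subgroup \<open>H\<close> of a free group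
  \<open>F\<close>, a transversal of the left cosets that is closed under suffixes exists by Zorn's lemma; it
  amounts to a map \<open>\<kappa> : F \<rightarrow> H\<close> with \<open>\<kappa> (u h) = \<kappa> u \<cdot> h\<close>. Then \<open>\<kappa> (a u) \<cdot> (\<kappa> u)\<inverse>\<close>, for a letter \<open>a\<close>, is a
  cocycle; recording its nontrivial values at positive letters as formal generators rewrites words
  over the letters of \<open>F\<close> into words over a set of elements of \<open>H\<close>. Restricted to \<open>H\<close>, this
  rewriting is a homomorphism inverse to the evaluation of words, so no cancellation argument is
  needed. Nontrivial normal subgroups of a noncommutative free group do not commute because they
  contain reduced words of the forms \<open>a \<dots> a\<inverse>\<close> and \<open>b \<dots> b\<inverse>\<close> for different generators \<open>a\<close>, \<open>b\<close>.\<close>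

section \<open>Free groups\<close>

lemma carrier_free_group_UNIV: "w \<in> carrier (free_group UNIV) \<longleftrightarrow> reduced w"
  by (simp add: free_group_def)

lemma mult_free_group: "u \<otimes>\<^bsub>free_group X\<^esub> v = foldr reduced_Cons u v"
  by (simp add: free_group_def)

lemma one_free_group: "\<one>\<^bsub>free_group X\<^esub> = []"
  by (simp add: free_group_def)

lemma hom_free_group_UNIV:
  assumes "f \<in> hom G (free_group X)"
  shows "f \<in> hom G (free_group UNIV)"
  using assms by (auto simp: hom_def free_group_def Pi_iff)

lemma set_foldr_reduced_Cons_subset:
  "fst ` set u \<subseteq> A \<Longrightarrow> fst ` set w \<subseteq> A \<Longrightarrow> fst ` set (foldr reduced_Cons u w) \<subseteq> A"
  by (meson le_sup_iff order_trans set_foldr_reduced_Cons)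

lemma reduced_Cons_cancel':
  "reduced w \<Longrightarrow> reduced_Cons (inv_letter a) (reduced_Cons a w) = w"
  using reduced_Cons_cancel[of w "inv_letter a"] by simp

lemma inv_free_group:
  assumes "u \<in> carrier (free_group X)"
  shows "inv\<^bsub>free_group X\<^esub> u = foldr reduced_Cons (rev (map inv_letter u)) []"
proof -
  interpret F: group "free_group X" by (rule group_free_group)
  have "foldr reduced_Cons (rev (map inv_letter u)) [] \<in> carrier (free_group X)"
    using assms order_trans[OF set_foldr_reduced_Cons[of "rev (map inv_letter u)" "[]"], of X]
    by (simp add: free_group_def reduced_foldr image_image)
  moreover have "foldr reduced_Cons (foldr reduced_Cons (rev (map inv_letter u)) []) u = []"
    using assms foldr_reduced_Cons_assoc[of u "rev (map inv_letter u)" "[]"]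
      foldr_reduced_Cons_inverse[of "[]" u] foldr_reduced_Cons_Nil[of u]
    by (simp add: free_group_def)
  ultimately show ?thesis
    using assms by (intro F.inv_equality) (simp_all add: mult_free_group one_free_group)
qed

text \<open>Inverse letters are inverses of generators, and prefixing a letter to a word that stays
  reduced is a product, so induction on words reaches the whole group.\<close>

lemma free_group_subgroup_eqI:
  assumes "subgroup H (free_group X)" and gen: "\<And>x. x \<in> X \<Longrightarrow> [(x, True)] \<in> H"
  shows "H = carrier (free_group X)"
proof
  interpret F: group "free_group X" by (rule group_free_group)
  interpret H: subgroup H "free_group X" by (rule assms)
  show "H \<subseteq> carrier (free_group X)" by (rule H.subset)
  have letter: "[(x, b)] \<in> H" if "x \<in> X" for x b
  proof (cases b)
    case False
    have "inv\<^bsub>free_group X\<^esub> [(x, True)] \<in> H"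
      using gen[OF that] by (rule H.m_inv_closed)
    then show ?thesis
      using that False
      by (subst (asm) inv_free_group) (simp_all add: free_group_def inv_letter_def reduced_def)
  qed (use gen[OF that] in simp)
  have "w \<in> H" if "reduced w" "fst ` set w \<subseteq> X" for w
    using that
  proof (induction w)
    case Nil
    show ?case using H.one_closed by (simp add: one_free_group)
  next
    case (Cons a w)
    then have "[a] \<otimes>\<^bsub>free_group X\<^esub> w \<in> H"
      using letter[of "fst a" "snd a"] by (intro H.m_closed) (auto dest: reduced_ConsD)
    then show ?case
      using Cons.prems by (simp add: mult_free_group reduced_Cons_reduced)
  qed
  then show "carrier (free_group X) \<subseteq> H"
    by (auto simp: free_group_def)
qed

lemma is_free_group_iso:
  fixes G :: "('a, 'm) monoid_scheme"
  assumes "is_free_group G"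
  obtains X :: "'a set" and f where "f \<in> iso G (free_group X)"
proof -
  obtain X :: "'a set" where "free_group X \<cong> G"
    using assms by (auto simp: is_free_group_def)
  then have "G \<cong> free_group X"
    by (rule group.iso_sym[OF group_free_group])
  then show thesis
    using that by (auto simp: is_iso_def)
qed

section \<open>Evaluation of formal words over a group\<close>

context group
begin

definition letter_value :: "'a letter \<Rightarrow> 'a" where
  "letter_value a = (if snd a then fst a else inv (fst a))"

definition word_value :: "'a letter list \<Rightarrow> 'a" where
  "word_value w = foldr (\<lambda>a r. letter_value a \<otimes> r) w \<one>"

lemma word_value_simps [simp]:
  "word_value [] = \<one>"
  "word_value (a # w) = letter_value a \<otimes> word_value w"
  by (simp_all add: word_value_def)

lemma letter_value_closed: "fst a \<in> carrier G \<Longrightarrow> letter_value a \<in> carrier G"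
  by (simp add: letter_value_def)

lemma word_value_closed: "fst ` set w \<subseteq> carrier G \<Longrightarrow> word_value w \<in> carrier G"
  by (induction w) (simp_all add: letter_value_closed)

lemma letter_value_inv_letter:
  "fst a \<in> carrier G \<Longrightarrow> letter_value (inv_letter a) = inv (letter_value a)"
  by (simp add: letter_value_def inv_letter_def)

text \<open>A letter and its inverse have inverse values, so cancellation leaves the value
  unchanged.\<close>

lemma word_value_reduced_Cons:
  assumes "fst a \<in> carrier G" "fst ` set w \<subseteq> carrier G"
  shows "word_value (reduced_Cons a w) = letter_value a \<otimes> word_value w"
proof (cases w)
  case (Cons b v)
  then show ?thesis
    using assms
    by (auto simp: letter_value_inv_letter letter_value_closed word_value_closed m_assoc[symmetric])
qed simp

lemma word_value_mult:
  assumes "fst ` set u \<subseteq> carrier G" "fst ` set w \<subseteq> carrier G"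
  shows "word_value (foldr reduced_Cons u w) = word_value u \<otimes> word_value w"
  using assms(1)
proof (induction u)
  case (Cons a u)
  then have "fst ` set (foldr reduced_Cons u w) \<subseteq> carrier G"
    using assms(2) by (intro set_foldr_reduced_Cons_subset) auto
  then show ?case
    using Cons assms(2)
    by (simp add: word_value_reduced_Cons letter_value_closed word_value_closed m_assoc)
qed (simp add: assms word_value_closed)

end


section \<open>Subgroups of free groups\<close>

text \<open>The function \<open>\<kappa>\<close> encodes a transversal, closed under taking suffixes, for the left cosets of
  the image of \<open>g\<close>: the transversal is the set of all \<open>t\<close> with \<open>\<kappa> t = \<one>\<close>, and the representative
  of the coset of \<open>u\<close> is \<open>u \<cdot> (g (\<kappa> u))\<inverse>\<close>.\<close>

locale schreier_section = group G for G (structure) +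
  fixes g :: "'a \<Rightarrow> 'x letter list" and \<kappa> :: "'x letter list \<Rightarrow> 'a"
  assumes g_hom: "g \<in> hom G (free_group UNIV)"
    and \<kappa>_closed: "reduced u \<Longrightarrow> \<kappa> u \<in> carrier G"
    and \<kappa>_mult: "reduced u \<Longrightarrow> h \<in> carrier G \<Longrightarrow> \<kappa> (foldr reduced_Cons u (g h)) = \<kappa> u \<otimes> h"
    and \<kappa>_Nil: "\<kappa> [] = \<one>"
    and \<kappa>_ConsD: "reduced (a # t) \<Longrightarrow> \<kappa> (a # t) = \<one> \<Longrightarrow> \<kappa> t = \<one>"
begin

text \<open>If \<open>s\<close> represents the coset of \<open>a u\<close> and \<open>t\<close> that
  of \<open>u\<close>, then \<open>g\<close> sends this value to the classical Schreier generator
  \<open>s\<inverse> a t\<close>.\<close>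

definition step_value :: "'x letter \<Rightarrow> 'x letter list \<Rightarrow> 'a" where
  "step_value a u = \<kappa> (reduced_Cons a u) \<otimes> inv (\<kappa> u)"

text \<open>A negative letter is recorded as the formal inverse of the generator of the reversed
  positive letter, so that a step and its reversal cancel as words and not only in value.\<close>

definition step :: "'x letter \<Rightarrow> 'x letter list \<Rightarrow> 'a letter list" where
  "step a u = (if step_value a u = \<one> then []
     else if snd a then [(step_value a u, True)] else [(inv (step_value a u), False)])"

text \<open>Words are read from the right: each letter is replaced by its step at the suffix read so
  far.\<close>

fun rewriting :: "'x letter list \<Rightarrow> 'a letter list" where
  "rewriting [] = []"
| "rewriting (a # w) = foldr reduced_Cons (step a w) (rewriting w)"

definition schreier_basis :: "'a set" where
  "schreier_basis = {step_value (x, True) u | x u. reduced u} - {\<one>}"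

lemma g_reduced: "h \<in> carrier G \<Longrightarrow> reduced (g h)"
  using hom_in_carrier[OF g_hom] by (simp add: carrier_free_group_UNIV)

lemma g_mult: "h \<in> carrier G \<Longrightarrow> k \<in> carrier G \<Longrightarrow> g (h \<otimes> k) = foldr reduced_Cons (g h) (g k)"
  using hom_mult[OF g_hom] by (simp add: mult_free_group)

lemma g_one: "g \<one> = []"
  using hom_one[OF g_hom is_group group_free_group] by (simp add: one_free_group)

lemma step_value_closed: "reduced u \<Longrightarrow> step_value a u \<in> carrier G"
  by (simp add: step_value_def \<kappa>_closed reduced_reduced_Cons)

lemma step_value_inverse:
  assumes "reduced u"
  shows "step_value (inv_letter a) (reduced_Cons a u) = inv (step_value a u)"
  using assms
  by (simp add: step_value_def reduced_Cons_cancel' \<kappa>_closed reduced_reduced_Cons inv_mult_group)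

lemma step_inverse:
  assumes "reduced u" "reduced v"
  shows "foldr reduced_Cons (step (inv_letter a) (reduced_Cons a u))
    (foldr reduced_Cons (step a u) v) = v"
proof -
  have "reduced_Cons (h, b) (reduced_Cons (h, \<not> b) v) = v" for h b
    using reduced_Cons_cancel[OF assms(2), of "(h, b)"] by (simp add: inv_letter_def)
  from this[of _ True] this[of _ False] show ?thesis
    using assms(1) step_value_closed[of u a]
    by (simp add: step_def step_value_inverse) (simp add: inv_letter_def)
qed

lemma step_in_basis:
  assumes "reduced u"
  shows "fst ` set (step a u) \<subseteq> schreier_basis"
proof (cases "snd a")
  case True
  then have "step_value a u \<in> schreier_basis" if "step_value a u \<noteq> \<one>"
    using that assms unfolding schreier_basis_def by (cases a) auto
  then show ?thesis
    using True by (simp add: step_def)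
next
  case False
  then have "inv_letter a = (fst a, True)" by (simp add: inv_letter_def)
  then have "inv (step_value a u) = step_value (fst a, True) (reduced_Cons a u)"
    using step_value_inverse[OF assms, of a] by simp
  then have "inv (step_value a u) \<in> schreier_basis" if "step_value a u \<noteq> \<one>"
    using that assms step_value_closed[OF assms, of a]
    unfolding schreier_basis_def by (auto intro!: reduced_reduced_Cons)
  then show ?thesis
    using False by (simp add: step_def)
qed

lemma reduced_rewriting: "reduced (rewriting w)"
  by (induction w) (simp_all add: reduced_foldr)

lemma rewriting_in_basis: "reduced w \<Longrightarrow> fst ` set (rewriting w) \<subseteq> schreier_basis"
proof (induction w)
  case (Cons a w)
  then have "reduced w" by (auto dest: reduced_ConsD)
  then show ?case
    using Cons.IH by (simp add: set_foldr_reduced_Cons_subset step_in_basis)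
qed simp

text \<open>In the cancelling case \<open>w\<close> starts with the inverse of \<open>a\<close>, and
  the steps of these two letters cancel by \<open>step_inverse\<close>.\<close>

lemma rewriting_reduced_Cons:
  assumes "reduced w"
  shows "rewriting (reduced_Cons a w) = foldr reduced_Cons (step a w) (rewriting w)"
proof (cases w)
  case (Cons b v)
  show ?thesis
  proof (cases "b = inv_letter a")
    case True
    have v: "reduced v" and w: "reduced_Cons b v = w"
      using assms Cons by (auto dest: reduced_ConsD simp: reduced_Cons_reduced)
    then show ?thesis
      using step_inverse[OF v reduced_rewriting, of b v] Cons True by simp
  qed (simp add: Cons)
qed simp

text \<open>The factor \<open>h\<close> enters both values of \<open>\<kappa>\<close> on the right
  and cancels in their quotient, so a step depends only on the left coset of the word.\<close>

lemma step_translate: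
  assumes "reduced u" "h \<in> carrier G"
  shows "step a (foldr reduced_Cons u (g h)) = step a u"
proof -
  have "reduced_Cons a (foldr reduced_Cons u (g h)) = foldr reduced_Cons (reduced_Cons a u) (g h)"
    using assms by (simp add: foldr_reduced_Cons_reduced_Cons g_reduced)
  moreover have "(x \<otimes> h) \<otimes> inv (y \<otimes> h) = x \<otimes> inv y"
    if "x \<in> carrier G" "y \<in> carrier G" for x y
    using that assms(2) by (simp add: inv_mult_group m_assoc[symmetric]) (simp add: m_assoc)
  ultimately have "step_value a (foldr reduced_Cons u (g h)) = step_value a u"
    using assms by (simp add: step_value_def \<kappa>_mult reduced_reduced_Cons \<kappa>_closed)
  then show ?thesis
    by (simp add: step_def)
qed

text \<open>The step of a letter depends on the suffix after it, so multiplicativity is not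
  automatic. A right factor from the image of \<open>g\<close> preserves the left cosets of all
  suffixes of \<open>u\<close>, hence their steps.\<close>

lemma rewriting_mult:
  assumes "reduced u" "h \<in> carrier G"
  shows "rewriting (foldr reduced_Cons u (g h)) = foldr reduced_Cons (rewriting u) (rewriting (g h))"
  using assms(1)
proof (induction u)
  case (Cons a u)
  then have "reduced u" by (auto dest: reduced_ConsD)
  then show ?case
    using Cons.IH assms(2)
    by (simp add: rewriting_reduced_Cons reduced_foldr g_reduced step_translate
        foldr_reduced_Cons_assoc reduced_rewriting)
qed simp

lemma word_value_step: "reduced u \<Longrightarrow> word_value (step a u) = step_value a u"
  using step_value_closed[of u a] by (simp add: step_def letter_value_def)

lemma basis_subset: "schreier_basis \<subseteq> carrier G"
  by (auto simp: schreier_basis_def step_value_closed)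

text \<open>The step values are quotients of \<open>\<kappa>\<close> at successive suffixes, and
  their product telescopes down to \<open>\<kappa> [] = \<one>\<close>.\<close>

lemma word_value_rewriting: "reduced w \<Longrightarrow> word_value (rewriting w) = \<kappa> w"
proof (induction w)
  case (Cons a w)
  then have w: "reduced w" by (auto dest: reduced_ConsD)
  have "word_value (rewriting (a # w)) = step_value a w \<otimes> \<kappa> w"
    using step_in_basis[OF w, of a] rewriting_in_basis[OF w] basis_subset Cons.IH w
    by (simp add: word_value_mult word_value_step)
  then show ?case
    using Cons.prems w
    by (simp add: step_value_def \<kappa>_closed m_assoc reduced_Cons_reduced)
qed (simp add: \<kappa>_Nil)

lemma \<kappa>_g: "h \<in> carrier G \<Longrightarrow> \<kappa> (g h) = h"
  using \<kappa>_mult[of "[]" h] by (simp add: \<kappa>_Nil)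

text \<open>By closure under suffixes \<open>\<kappa>\<close> is trivial on every suffix, so no step
  contributes a letter.\<close>

lemma rewriting_transversal: "reduced t \<Longrightarrow> \<kappa> t = \<one> \<Longrightarrow> rewriting t = []"
proof (induction t)
  case (Cons a t)
  then have "reduced t" "\<kappa> t = \<one>"
    using \<kappa>_ConsD by (auto dest: reduced_ConsD)
  then show ?case
    using Cons by (simp add: step_def step_value_def reduced_Cons_reduced)
qed simp

text \<open>Factor \<open>u\<close> as \<open>t\<close> times \<open>g (\<kappa> u)\<close> with
  \<open>\<kappa> t = \<one>\<close>; the transversal part \<open>t\<close> rewrites to the empty
  word.\<close>

lemma rewriting_eq_rewriting_g:
  assumes u: "reduced u"
  shows "rewriting u = rewriting (g (\<kappa> u))"
proof -
  define t where "t = foldr reduced_Cons u (g (inv (\<kappa> u)))"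
  have k: "\<kappa> u \<in> carrier G" using \<kappa>_closed[OF u] .
  have t: "reduced t" "\<kappa> t = \<one>"
    using u k by (simp_all add: t_def reduced_foldr g_reduced \<kappa>_mult)
  have "foldr reduced_Cons t (g (\<kappa> u)) = foldr reduced_Cons u []"
    using k u by (simp add: t_def foldr_reduced_Cons_assoc g_reduced g_mult[symmetric] g_one)
  then show ?thesis
    using rewriting_mult[OF t(1) k] u by (simp add: rewriting_transversal[OF t] foldr_reduced_Cons_Nil)
qed

text \<open>Replacing \<open>u\<close> by the representative \<open>t\<close> of its coset keeps the
  step. Then \<open>\<kappa>\<close> sends \<open>(x, True)\<close> times \<open>t\<close> to
  \<open>y\<close>, and since \<open>t\<close> rewrites to nothing, only this single step
  remains.\<close>

lemma rewriting_basis: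
  assumes "y \<in> schreier_basis"
  shows "rewriting (g y) = [(y, True)]"
proof -
  obtain x u where u: "reduced u" and y: "y = step_value (x, True) u" "y \<noteq> \<one>"
    using assms by (auto simp: schreier_basis_def)
  define t where "t = foldr reduced_Cons u (g (inv (\<kappa> u)))"
  have k: "\<kappa> u \<in> carrier G" using \<kappa>_closed[OF u] .
  have t: "reduced t" "\<kappa> t = \<one>"
    using u k by (simp_all add: t_def reduced_foldr g_reduced \<kappa>_mult)
  have step: "step (x, True) t = [(y, True)]"
    using step_translate[OF u, of "inv (\<kappa> u)" "(x, True)"] k y by (simp add: t_def step_def)
  then have "step_value (x, True) t = y"
    by (simp add: step_def split: if_splits)
  then have "\<kappa> (reduced_Cons (x, True) t) = y"
    using t \<kappa>_closed[OF reduced_reduced_Cons[OF t(1)]] by (simp add: step_value_def)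
  then have "rewriting (g y) = rewriting (reduced_Cons (x, True) t)"
    using rewriting_eq_rewriting_g[OF reduced_reduced_Cons[OF t(1), of "(x, True)"]] by simp
  also have "\<dots> = [(y, True)]"
    by (simp add: rewriting_reduced_Cons[OF t(1)] rewriting_transversal[OF t] step)
  finally show ?thesis .
qed

text \<open>Evaluation of words is a left inverse, which gives injectivity; the image is a subgroup
  containing every generator by \<open>rewriting_basis\<close>, which gives surjectivity.\<close>

lemma rewriting_iso: "(\<lambda>h. rewriting (g h)) \<in> iso G (free_group schreier_basis)"
proof -
  let ?\<Psi> = "\<lambda>h. rewriting (g h)"
  have hom: "?\<Psi> \<in> hom G (free_group schreier_basis)"
    by (rule homI)
      (simp_all add: free_group_def g_mult g_reduced rewriting_mult reduced_rewriting rewriting_in_basis)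
  interpret \<Psi>: group_hom G "free_group schreier_basis" ?\<Psi>
    by (intro group_hom.intro group_hom_axioms.intro is_group group_free_group hom)
  have "inj_on ?\<Psi> (carrier G)"
    by (rule inj_on_inverseI[where g = word_value]) (simp add: word_value_rewriting g_reduced \<kappa>_g)
  moreover have "?\<Psi> ` carrier G = carrier (free_group schreier_basis)"
  proof (rule free_group_subgroup_eqI)
    show "subgroup (?\<Psi> ` carrier G) (free_group schreier_basis)"
      by (rule \<Psi>.img_is_subgroup)
  next
    fix y assume "y \<in> schreier_basis"
    then show "[(y, True)] \<in> ?\<Psi> ` carrier G"
      using basis_subset rewriting_basis by (metis image_eqI subsetD)
  qed
  ultimately show ?thesis
    using hom by (simp add: iso_def bij_betw_def)
qed

lemma is_free_group: "is_free_group G"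
  using is_group iso_sym[OF is_isoI[OF rewriting_iso]] unfolding is_free_group_def by blast

end

section \<open>Existence of Schreier transversals\<close>

text \<open>These are partial transversals: the last clause says that distinct words of
  \<open>T\<close> lie in distinct left cosets of \<open>H\<close>.\<close>

definition schreier_system :: "'x letter list set \<Rightarrow> 'x letter list set \<Rightarrow> bool" where
  "schreier_system H T \<longleftrightarrow> [] \<in> T \<and> (\<forall>t\<in>T. reduced t) \<and> (\<forall>a t. a # t \<in> T \<longrightarrow> t \<in> T) \<and>
     (\<forall>t\<in>T. \<forall>h\<in>H. foldr reduced_Cons t h \<in> T \<longrightarrow> h = [])"

text \<open>Suffix closure survives because \<open>a\<close> does not cancel against
  \<open>t\<close>: a cancellation would give a suffix of \<open>t\<close>, which is in
  \<open>T\<close> already, whereas the coset of the new word avoids \<open>T\<close>.\<close>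

lemma schreier_system_extend:
  assumes H: "subgroup H (free_group UNIV)" and T: "schreier_system H T" "t \<in> T"
    and new: "\<And>s h. s \<in> T \<Longrightarrow> h \<in> H \<Longrightarrow> reduced_Cons a t \<noteq> foldr reduced_Cons s h"
  shows "schreier_system H (insert (reduced_Cons a t) T)"
proof -
  interpret F: group "free_group UNIV" by (rule group_free_group)
  interpret H: subgroup H "free_group UNIV" by (rule H)
  let ?u = "reduced_Cons a t"
  have t: "reduced t" using T by (simp add: schreier_system_def)
  then have u: "reduced ?u" by (rule reduced_reduced_Cons)
  have Hred: "reduced h" if "h \<in> H" for h
    using H.mem_carrier[OF that] by (simp add: carrier_free_group_UNIV)
  have Nil: "[] \<in> H" using H.one_closed by (simp add: one_free_group)
  have unew: "?u \<notin> T"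
    using new[of ?u "[]"] Nil u by (auto simp: foldr_reduced_Cons_Nil)
  have "?u = a # t"
  proof (cases t)
    case (Cons b v)
    then have "v \<in> T" using T unfolding schreier_system_def by blast
    then show ?thesis using unew Cons by auto
  qed simp
  moreover have "h = []" if "h \<in> H" "foldr reduced_Cons ?u h \<in> T" for h
  proof -
    have hc: "h \<in> carrier (free_group UNIV)" "?u \<in> carrier (free_group UNIV)"
      using Hred[OF that(1)] u by (simp_all add: carrier_free_group_UNIV)
    then have "?u = (?u \<otimes>\<^bsub>free_group UNIV\<^esub> h) \<otimes>\<^bsub>free_group UNIV\<^esub> inv\<^bsub>free_group UNIV\<^esub> h"
      by (simp add: F.m_assoc)
    then show ?thesis
      using new[OF that(2) H.m_inv_closed[OF that(1)]] by (simp add: mult_free_group)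
  qed
  moreover have "h = []" if "h \<in> H" "foldr reduced_Cons ?u h = ?u" for h
  proof -
    have "?u \<otimes>\<^bsub>free_group UNIV\<^esub> h = ?u"
      using that by (simp add: mult_free_group)
    then show ?thesis
      using Hred[OF that(1)] u
      by (simp add: carrier_free_group_UNIV one_free_group)
  qed
  ultimately show ?thesis
    using T u new unfolding schreier_system_def by (metis insert_iff list.inject)
qed

text \<open>A maximal system, given by Zorn's lemma, meets every coset: a missed coset one letter
  away from \<open>T\<close> could be added by \<open>schreier_system_extend\<close>.\<close>

lemma schreier_transversal_exists:
  assumes H: "subgroup H (free_group UNIV)"
  obtains T where "schreier_system H T"
    "\<And>u. reduced u \<Longrightarrow> \<exists>t\<in>T. \<exists>h\<in>H. u = foldr reduced_Cons t h"
proof -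
  interpret H: subgroup H "free_group UNIV" by (rule H)
  have Hred: "reduced h" if "h \<in> H" for h
    using H.mem_carrier[OF that] by (simp add: carrier_free_group_UNIV)
  have Nil: "[] \<in> H" using H.one_closed by (simp add: one_free_group)
  have "\<exists>M\<in>{T. schreier_system H T}. \<forall>X\<in>{T. schreier_system H T}. M \<subseteq> X \<longrightarrow> X = M"
  proof (rule subset_Zorn_nonempty)
    have "schreier_system H {[]}"
      using Hred by (auto simp: schreier_system_def)
    then show "{T. schreier_system H T} \<noteq> {}" by blast
  next
    fix C assume C: "C \<noteq> {}" "subset.chain {T. schreier_system H T} C"
    have "h = []" if sh: "s \<in> \<Union>C" "h \<in> H" "foldr reduced_Cons s h \<in> \<Union>C" for s h
    proof -
      obtain A B where AB: "A \<in> C" "B \<in> C" "s \<in> A" "foldr reduced_Cons s h \<in> B"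
        using sh by blast
      then have "A \<subseteq> B \<or> B \<subseteq> A"
        using C(2) by (auto simp: subset_chain_def)
      then obtain D where "D \<in> C" "s \<in> D" "foldr reduced_Cons s h \<in> D"
        using AB by blast
      moreover have "schreier_system H D"
        using \<open>D \<in> C\<close> C(2) by (auto simp: subset_chain_def)
      ultimately show ?thesis
        using sh(2) by (simp add: schreier_system_def)
    qed
    moreover have "schreier_system H T" if "T \<in> C" for T
      using that C(2) by (auto simp: subset_chain_def)
    ultimately show "\<Union>C \<in> {T. schreier_system H T}"
      using C(1) unfolding schreier_system_def mem_Collect_eq by blast
  qed
  then obtain T where T: "schreier_system H T"
    and max: "\<And>S. schreier_system H S \<Longrightarrow> T \<subseteq> S \<Longrightarrow> S = T"
    by blast
  have "\<exists>t\<in>T. \<exists>h\<in>H. u = foldr reduced_Cons t h" if "reduced u" for u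
    using that
  proof (induction u)
    case Nil
    then show ?case
      using T \<open>[] \<in> H\<close> by (intro bexI[of _ "[]"]) (auto simp: schreier_system_def)
  next
    case (Cons a u)
    then obtain t h where t: "t \<in> T" "h \<in> H" "u = foldr reduced_Cons t h"
      by (auto dest: reduced_ConsD)
    have tr: "reduced t" using t T by (simp add: schreier_system_def)
    \<comment> \<open>The words \<open>a # u\<close> and \<open>reduced_Cons a t\<close> lie in the
      same left coset, so it suffices to cover the latter.\<close>
    have "\<exists>s\<in>T. \<exists>k\<in>H. reduced_Cons a t = foldr reduced_Cons s k"
    proof (rule ccontr)
      assume none: "\<not> ?thesis"
      then have "insert (reduced_Cons a t) T = T"
        by (intro max schreier_system_extend[OF H T t(1)]) auto
      then have "reduced_Cons a t \<in> T" by blast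
      moreover have "reduced_Cons a t = foldr reduced_Cons (reduced_Cons a t) []"
        using tr by (simp add: foldr_reduced_Cons_Nil reduced_reduced_Cons)
      ultimately show False using none Nil by blast
    qed
    then obtain s k where s: "s \<in> T" "k \<in> H" "reduced_Cons a t = foldr reduced_Cons s k"
      by blast
    have "a # u = reduced_Cons a (foldr reduced_Cons t h)"
      using Cons.prems t by (simp add: reduced_Cons_reduced)
    also have "\<dots> = foldr reduced_Cons (foldr reduced_Cons s k) h"
      using Hred[OF t(2)] by (simp add: foldr_reduced_Cons_reduced_Cons s(3)[symmetric])
    also have "\<dots> = foldr reduced_Cons s (foldr reduced_Cons k h)"
      using Hred[OF t(2)] by (rule foldr_reduced_Cons_assoc)
    finally show ?case
      using s H.m_closed[OF s(2) t(2)] by (auto simp: mult_free_group)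
  qed
  with T show thesis by (rule that)
qed

text \<open>A transversal for the image of \<open>g\<close> splits each reduced word uniquely as
  \<open>t\<close> times \<open>g h\<close>, and \<open>\<kappa>\<close> reads off \<open>h\<close>.
  Working with an embedding of \<open>G\<close> puts the basis into the type of \<open>G\<close>, as
  \<open>is_free_group\<close> asks.\<close>

theorem nielsen_schreier:
  fixes G :: "('a, 'm) monoid_scheme" (structure) and g :: "'a \<Rightarrow> 'x letter list"
  assumes G: "group G" and g: "g \<in> hom G (free_group X)" and inj: "inj_on g (carrier G)"
  shows "is_free_group G"
proof -
  interpret G: group G by (rule G)
  interpret g: group_hom G "free_group UNIV" g
    by (intro group_hom.intro group_hom_axioms.intro G group_free_group hom_free_group_UNIV[OF g])
  note [simp del] = g.hom_mult g.hom_inv g.hom_one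
  have gred: "reduced (g h)" if "h \<in> carrier G" for h
    using g.hom_closed[OF that] by (simp add: carrier_free_group_UNIV)
  have gmult: "g (h \<otimes> k) = foldr reduced_Cons (g h) (g k)"
    if "h \<in> carrier G" "k \<in> carrier G" for h k
    using g.hom_mult[OF that] by (simp add: mult_free_group)
  have gone: "g \<one> = []" using g.hom_one by (simp add: one_free_group)
  obtain T where T: "schreier_system (g ` carrier G) T"
    and cover: "\<And>u. reduced u \<Longrightarrow> \<exists>t\<in>T. \<exists>h\<in>g ` carrier G. u = foldr reduced_Cons t h"
    using schreier_transversal_exists[OF g.img_is_subgroup] by blast
  have Tred: "reduced t" if "t \<in> T" for t
    using T that by (simp add: schreier_system_def)
  \<comment> \<open>Translating \<open>s\<close> by \<open>g (h \<otimes> inv k)\<close> gives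
    \<open>t\<close>; as both lie in \<open>T\<close>, the translating element is trivial.\<close>
  have unique: "h = k" if st: "s \<in> T" "t \<in> T" and hk: "h \<in> carrier G" "k \<in> carrier G"
    and eq: "foldr reduced_Cons s (g h) = foldr reduced_Cons t (g k)" for s t h k
  proof -
    have "foldr reduced_Cons s (g (h \<otimes> inv k))
        = foldr reduced_Cons (foldr reduced_Cons t (g k)) (g (inv k))"
      using hk by (simp add: gmult eq[symmetric] foldr_reduced_Cons_assoc gred)
    also have "\<dots> = foldr reduced_Cons t (g (k \<otimes> inv k))"
      unfolding gmult[OF hk(2) G.inv_closed[OF hk(2)]]
      by (intro foldr_reduced_Cons_assoc gred G.inv_closed hk)
    also have "\<dots> = t"
      using hk st by (simp add: gone foldr_reduced_Cons_Nil Tred)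
    finally have "foldr reduced_Cons s (g (h \<otimes> inv k)) = t" .
    moreover have "g (h \<otimes> inv k) \<in> g ` carrier G"
      using hk by simp
    ultimately have "g (h \<otimes> inv k) = []"
      using T st unfolding schreier_system_def by blast
    then have "h \<otimes> inv k = \<one>"
      using inj_onD[OF inj, of "h \<otimes> inv k" \<one>] hk gone by simp
    then show "h = k"
      using hk G.inv_equality[of h "inv k"] by simp
  qed
  define \<kappa> where "\<kappa> u = (THE h. h \<in> carrier G \<and> (\<exists>t\<in>T. u = foldr reduced_Cons t (g h)))" for u
  have \<kappa>_eq: "\<kappa> (foldr reduced_Cons t (g h)) = h" if "t \<in> T" "h \<in> carrier G" for t h
    unfolding \<kappa>_def using that unique by (intro the_equality) blast+
  interpret schreier_section G g \<kappa>
  proof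
    show "g \<in> hom G (free_group UNIV)" by (rule g.homh)
  next
    fix u :: "'x letter list" assume "reduced u"
    then obtain t k where u: "t \<in> T" "k \<in> carrier G" "u = foldr reduced_Cons t (g k)"
      using cover by blast
    then show "\<kappa> u \<in> carrier G" by (simp add: \<kappa>_eq)
    fix h assume h: "h \<in> carrier G"
    have "foldr reduced_Cons u (g h) = foldr reduced_Cons t (g (k \<otimes> h))"
      using u h by (simp add: foldr_reduced_Cons_assoc gred gmult)
    then show "\<kappa> (foldr reduced_Cons u (g h)) = \<kappa> u \<otimes> h"
      using u h by (simp add: \<kappa>_eq)
  next
    show "\<kappa> [] = \<one>"
      using \<kappa>_eq[of "[]" \<one>] T by (simp add: gone schreier_system_def)
  next
    fix a :: "'x letter" and t assume at: "reduced (a # t)" "\<kappa> (a # t) = \<one>"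
    then obtain s k where s: "s \<in> T" "k \<in> carrier G" "a # t = foldr reduced_Cons s (g k)"
      using cover by blast
    \<comment> \<open>A word on which \<open>\<kappa>\<close> is trivial is its own representative,
      so it lies in \<open>T\<close>, and so does its tail.\<close>
    with at have "k = \<one>" by (simp add: \<kappa>_eq)
    with s have "a # t \<in> T" by (simp add: gone foldr_reduced_Cons_Nil Tred)
    then have "t \<in> T" using T unfolding schreier_system_def by blast
    then show "\<kappa> t = \<one>"
      using \<kappa>_eq[of t \<one>] by (simp add: gone foldr_reduced_Cons_Nil Tred)
  qed
  show ?thesis by (rule is_free_group)
qed


section \<open>Commuting normal subgroups\<close>

lemma inv_letter_neq [simp]: "inv_letter a \<noteq> a" "a \<noteq> inv_letter a"
  by (auto simp: inv_letter_def prod_eq_iff)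

lemma inv_letter_inject [simp]: "inv_letter a = inv_letter b \<longleftrightarrow> a = b"
  by (metis inv_letter_inv_letter)

lemma reduced_singleton [simp]: "reduced [a]"
  by (simp add: reduced_def)

lemma reduced_append:
  "reduced (u @ v) \<longleftrightarrow> reduced u \<and> reduced v \<and> (u \<noteq> [] \<and> v \<noteq> [] \<longrightarrow> hd v \<noteq> inv_letter (last u))"
  by (auto simp: reduced_def successively_append_iff)

lemma foldr_reduced_Cons_append: "reduced (u @ v) \<Longrightarrow> foldr reduced_Cons u v = u @ v"
proof (induction u)
  case (Cons a u)
  then have "reduced (u @ v)" using reduced_ConsD[of a "u @ v"] by simp
  then show ?case using Cons by (simp add: reduced_Cons_reduced)
qed simp

lemma conjugate_by_letter:
  assumes w: "w \<in> carrier (free_group X)" "w \<noteq> []" and a: "fst a \<in> X"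
    and ends: "hd w \<noteq> inv_letter a" "last w \<noteq> a"
  shows "[a] \<otimes>\<^bsub>free_group X\<^esub> w \<otimes>\<^bsub>free_group X\<^esub> inv\<^bsub>free_group X\<^esub> [a] = a # w @ [inv_letter a]"
proof -
  have "inv\<^bsub>free_group X\<^esub> [a] = [inv_letter a]"
    using a by (subst inv_free_group) (simp_all add: free_group_def)
  moreover have aw: "reduced (a # w)"
    using w ends reduced_append[of "[a]" w] by (simp add: free_group_def)
  moreover have red: "reduced ((a # w) @ [inv_letter a])"
    unfolding reduced_append[of "a # w"] using aw w(2) ends(2) by simp
  ultimately show ?thesis
    using foldr_reduced_Cons_append[OF red] by (simp add: mult_free_group reduced_Cons_reduced)
qed

text \<open>Conjugating \<open>w\<close> by \<open>a\<close> directly might cancel at its ends. A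
  first conjugation by a suitable letter \<open>c\<close> produces known ends, at which
  \<open>a\<close> does not cancel; if \<open>c = a\<close>, it already suffices.\<close>

lemma normal_contains_conjugate_shape:
  assumes N: "N \<lhd> free_group X" and w: "w \<in> N" "w \<noteq> []"
    and xy: "x \<in> X" "y \<in> X" "x \<noteq> y" and a: "fst a \<in> X"
  shows "\<exists>v. a # v @ [inv_letter a] \<in> N"
proof -
  interpret N: normal N "free_group X" by (rule N)
  have wc: "w \<in> carrier (free_group X)" using w N.subset by blast
  \<comment> \<open>Two generators give four letters, of which at most three are excluded: two that
    would cancel at an end of \<open>w\<close>, and one that would cancel when conjugating by
    \<open>a\<close> afterwards.\<close>
  have "\<exists>c. c \<in> {(x, True), (x, False), (y, True), (y, False)}
      \<and> c \<notin> {inv_letter (hd w), last w, inv_letter a}"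
  proof (rule ccontr)
    assume "\<not> ?thesis"
    then have "{(x, True), (x, False), (y, True), (y, False)}
        \<subseteq> {inv_letter (hd w), last w, inv_letter a}"
      by blast
    then have "card {(x, True), (x, False), (y, True), (y, False)}
        \<le> card {inv_letter (hd w), last w, inv_letter a}"
      by (rule card_mono[rotated]) simp
    also have "\<dots> \<le> 3" by (simp add: card_insert_if)
    finally show False using xy by simp
  qed
  then obtain c where c': "c \<in> {(x, True), (x, False), (y, True), (y, False)}"
    "c \<notin> {inv_letter (hd w), last w, inv_letter a}"
    by blast
  then have c: "fst c \<in> X" "hd w \<noteq> inv_letter c" "last w \<noteq> c" "c \<noteq> inv_letter a"
    using xy by auto
  have letter: "[b] \<in> carrier (free_group X)" if "fst b \<in> X" for b
    using that by (simp add: free_group_def)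
  have cw: "c # w @ [inv_letter c] \<in> N"
    using N.inv_op_closed2[OF letter[OF c(1)] w(1)] conjugate_by_letter[OF wc w(2) c(1-3)] by simp
  show ?thesis
  proof (cases "c = a")
    case False
    have "inv_letter c \<noteq> a" using c(4) by auto
    then have "[a] \<otimes>\<^bsub>free_group X\<^esub> (c # w @ [inv_letter c]) \<otimes>\<^bsub>free_group X\<^esub> inv\<^bsub>free_group X\<^esub> [a]
        = a # (c # w @ [inv_letter c]) @ [inv_letter a]"
      using N.mem_carrier[OF cw] a c(4) by (intro conjugate_by_letter) simp_all
    then show ?thesis
      using N.inv_op_closed2[OF letter[OF a] cw] by metis
  qed (use cw in blast)
qed

text \<open>Take a word of \<open>I\<close> from \<open>x\<close> to its inverse and a word of
  \<open>J\<close> from \<open>y\<close> to its inverse. Their concatenations in either order are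
  reduced and start with different letters, so the two words do not commute.\<close>

lemma free_group_commuting_normal:
  assumes N: "I \<lhd> free_group X" "J \<lhd> free_group X"
    and xy: "x \<in> X" "y \<in> X" "x \<noteq> y"
    and comm: "\<And>u v. u \<in> I \<Longrightarrow> v \<in> J \<Longrightarrow> u \<otimes>\<^bsub>free_group X\<^esub> v = v \<otimes>\<^bsub>free_group X\<^esub> u"
  shows "I \<subseteq> {[]} \<or> J \<subseteq> {[]}"
proof (rule ccontr)
  assume "\<not> ?thesis"
  then obtain u v where uv: "u \<in> I" "u \<noteq> []" "v \<in> J" "v \<noteq> []"
    by blast
  obtain p where p: "(x, True) # p @ [inv_letter (x, True)] \<in> I" (is "?p \<in> I")
    using normal_contains_conjugate_shape[OF N(1) uv(1,2) xy, of "(x, True)"] xy by auto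
  obtain q where q: "(y, True) # q @ [inv_letter (y, True)] \<in> J" (is "?q \<in> J")
    using normal_contains_conjugate_shape[OF N(2) uv(3,4) xy, of "(y, True)"] xy by auto
  have "?p \<in> carrier (free_group X)" "?q \<in> carrier (free_group X)"
    using p q normal_imp_subgroup[OF N(1)] normal_imp_subgroup[OF N(2)]
    by (blast dest: subgroup.mem_carrier)+
  then have red: "reduced ?p" "reduced ?q"
    by (simp_all only: free_group_def partial_object.simps mem_Collect_eq)
  then have "reduced (?p @ ?q)" "reduced (?q @ ?p)"
    using xy(3) unfolding reduced_append[of ?p ?q] reduced_append[of ?q ?p]
    by (auto simp: inv_letter_def)
  then have "?p @ ?q = ?q @ ?p"
    using comm[OF p q] by (simp only: mult_free_group foldr_reduced_Cons_append)
  then show False using xy(3) by simp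
qed

section \<open>Rank and commutativity\<close>

lemma reduced_Cons_commute:
  assumes "fst a = fst b" "reduced w"
  shows "reduced_Cons a (reduced_Cons b w) = reduced_Cons b (reduced_Cons a w)"
proof (cases "a = b")
  case False
  then have "b = inv_letter a"
    using assms(1) by (cases a; cases b) (auto simp: inv_letter_def)
  then show ?thesis
    using assms(2) by (simp add: reduced_Cons_cancel reduced_Cons_cancel')
qed simp

text \<open>This rules out bases with at most one element: letters over a single generator are equal
  or inverse to each other, hence commute.\<close>

lemma free_group_rank_le_one_commute:
  assumes X: "X \<subseteq> {x}" and uv: "u \<in> carrier (free_group X)" "v \<in> carrier (free_group X)"
  shows "u \<otimes>\<^bsub>free_group X\<^esub> v = v \<otimes>\<^bsub>free_group X\<^esub> u"
proof -
  have move: "foldr reduced_Cons u (reduced_Cons a w) = reduced_Cons a (foldr reduced_Cons u w)"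
    if "fst ` set u \<subseteq> {x}" "fst a = x" "reduced w" for u a w
    using that by (induction u) (auto simp: reduced_Cons_commute reduced_foldr)
  have u: "fst ` set u \<subseteq> {x}" "reduced u" and v: "fst ` set v \<subseteq> {x}" "reduced v"
    using uv order_trans[OF _ X] by (simp_all add: free_group_def)
  from v have "foldr reduced_Cons u v = foldr reduced_Cons v u"
  proof (induction v)
    case (Cons a v)
    then have v: "reduced v" by (auto dest: reduced_ConsD)
    have "foldr reduced_Cons u (reduced_Cons a v) = reduced_Cons a (foldr reduced_Cons u v)"
      using move[OF u(1) _ v] Cons.prems by simp
    then show ?case
      using Cons v by (simp add: reduced_Cons_reduced)
  qed (simp add: foldr_reduced_Cons_Nil u)
  then show ?thesis
    by (simp add: mult_free_group)
qed

text \<open>The products of the two generators in either order are different reduced words, and the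
  structure map is injective.\<close>

lemma F2_group_not_commutative:
  assumes "is_F2_group L"
  obtains u v where "u \<in> carrier (fst L)" "v \<in> carrier (fst L)"
    "u \<otimes>\<^bsub>fst L\<^esub> v \<noteq> v \<otimes>\<^bsub>fst L\<^esub> u"
proof -
  have hom: "snd L \<in> hom F2 (fst L)" and inj: "inj_on (snd L) (carrier F2)"
    using assms by (auto simp: is_F2_group_def)
  have gen: "[(b, True)] \<in> carrier F2" for b
    by (simp add: F2_def free_group_def reduced_def)
  have prod: "[(b, True)] \<otimes>\<^bsub>F2\<^esub> [(c, True)] = [(b, True), (c, True)]" for b c
    by (simp add: F2_def mult_free_group inv_letter_def)
  have closed: "[(b, True), (c, True)] \<in> carrier F2" for b c
    by (simp add: F2_def free_group_def reduced_def inv_letter_def)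
  have "snd L [(True, True)] \<otimes>\<^bsub>fst L\<^esub> snd L [(False, True)]
      \<noteq> snd L [(False, True)] \<otimes>\<^bsub>fst L\<^esub> snd L [(True, True)]"
    using inj_onD[OF inj _ closed closed, of True False False True]
    by (auto simp: hom_mult[OF hom gen gen, symmetric] prod)
  then show thesis
    by (rule that[OF hom_in_carrier[OF hom gen] hom_in_carrier[OF hom gen]])
qed

lemma commutator_subgroup_trivial_commute:
  assumes G: "group G" and UV: "U \<subseteq> carrier G" "V \<subseteq> carrier G"
    and triv: "commutator_subgroup G U V = {\<one>\<^bsub>G\<^esub>}" and uv: "u \<in> U" "v \<in> V"
  shows "u \<otimes>\<^bsub>G\<^esub> v = v \<otimes>\<^bsub>G\<^esub> u"
proof -
  interpret group G by (rule G)
  have c: "u \<in> carrier G" "v \<in> carrier G" using UV uv by auto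
  have "u \<otimes>\<^bsub>G\<^esub> v \<otimes>\<^bsub>G\<^esub> inv\<^bsub>G\<^esub> u \<otimes>\<^bsub>G\<^esub> inv\<^bsub>G\<^esub> v \<in> commutator_subgroup G U V"
    unfolding commutator_subgroup_def using uv by blast
  then have "u \<otimes>\<^bsub>G\<^esub> v \<otimes>\<^bsub>G\<^esub> inv\<^bsub>G\<^esub> u \<otimes>\<^bsub>G\<^esub> inv\<^bsub>G\<^esub> v = \<one>\<^bsub>G\<^esub>"
    unfolding triv by simp
  then have "(u \<otimes>\<^bsub>G\<^esub> v) \<otimes>\<^bsub>G\<^esub> inv\<^bsub>G\<^esub> (v \<otimes>\<^bsub>G\<^esub> u) = \<one>\<^bsub>G\<^esub>"
    using c by (simp add: inv_mult_group m_assoc)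
  then show ?thesis
    using c inv_equality[of "u \<otimes>\<^bsub>G\<^esub> v" "inv\<^bsub>G\<^esub> (v \<otimes>\<^bsub>G\<^esub> u)"] by simp
qed

text \<open>An isomorphism onto a group of reduced words reduces this to
  \<open>free_group_commuting_normal\<close>; the embedded copy of \<open>F2\<close> forces two
  different basis elements.\<close>

lemma free_F2_group_commuting_normal:
  fixes L :: "'u F2_group"
  assumes L: "L \<in> free_F2_groups" and N: "I \<lhd> fst L" "J \<lhd> fst L"
    and triv: "commutator_subgroup (fst L) I J = {\<one>\<^bsub>fst L\<^esub>}"
  shows "I = {\<one>\<^bsub>fst L\<^esub>} \<or> J = {\<one>\<^bsub>fst L\<^esub>}"
proof -
  define G where "G = fst L"
  have F2: "is_F2_group L" and "is_free_group G"
    using L by (auto simp: free_F2_groups_def G_def)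
  then have G: "group G"
    by (simp add: is_free_group_def)
  obtain X :: "'u set" and f where f: "f \<in> iso G (free_group X)"
    by (rule is_free_group_iso[OF \<open>is_free_group G\<close>])
  interpret G: group G by (rule G)
  have hom: "f \<in> hom G (free_group X)"
    using f by (simp add: iso_def)
  interpret f: group_hom G "free_group X" f
    by (intro group_hom.intro group_hom_axioms.intro G group_free_group hom)
  have inj: "inj_on f (carrier G)"
    using f by (simp add: iso_def bij_betw_def)
  have NG: "I \<lhd> G" "J \<lhd> G" using N by (simp_all add: G_def)
  interpret I: normal I G by (rule NG)
  interpret J: normal J G by (rule NG)
  have not_cyclic: "\<not> X \<subseteq> {x}" for x
  proof
    assume X: "X \<subseteq> {x}"
    obtain u v where uv: "u \<in> carrier G" "v \<in> carrier G" "u \<otimes>\<^bsub>G\<^esub> v \<noteq> v \<otimes>\<^bsub>G\<^esub> u"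
      using F2_group_not_commutative[OF F2] unfolding G_def by blast
    have "f (u \<otimes>\<^bsub>G\<^esub> v) = f (v \<otimes>\<^bsub>G\<^esub> u)"
      unfolding f.hom_mult[OF uv(1,2)] f.hom_mult[OF uv(2,1)]
      by (intro free_group_rank_le_one_commute[OF X] f.hom_closed uv)
    then have "u \<otimes>\<^bsub>G\<^esub> v = v \<otimes>\<^bsub>G\<^esub> u"
      by (rule inj_onD[OF inj]) (intro G.m_closed uv)+
    with uv(3) show False by contradiction
  qed
  \<comment> \<open>The value \<open>undefined\<close> stands for an arbitrary element: a set
    contained in no singleton is nonempty.\<close>
  obtain x where "x \<in> X"
    using not_cyclic[of undefined] by blast
  moreover obtain y where "y \<in> X" "x \<noteq> y"
    using not_cyclic[of x] by blast
  ultimately have xy: "x \<in> X" "y \<in> X" "x \<noteq> y"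
    by blast+
  have sub: "f ` I \<subseteq> {[]} \<or> f ` J \<subseteq> {[]}"
  proof (rule free_group_commuting_normal[OF _ _ xy])
    show "f ` I \<lhd> free_group X" "f ` J \<lhd> free_group X"
      by (rule iso_normal_subgroup[OF f G group_free_group NG(1)],
          rule iso_normal_subgroup[OF f G group_free_group NG(2)])
  next
    fix u v assume "u \<in> f ` I" "v \<in> f ` J"
    then obtain i j where ij: "i \<in> I" "j \<in> J" "u = f i" "v = f j" by blast
    then have "i \<otimes>\<^bsub>G\<^esub> j = j \<otimes>\<^bsub>G\<^esub> i"
      using commutator_subgroup_trivial_commute[OF G I.subset J.subset] triv
      unfolding G_def by blast
    then have "f (i \<otimes>\<^bsub>G\<^esub> j) = f (j \<otimes>\<^bsub>G\<^esub> i)" by simp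
    then show "u \<otimes>\<^bsub>free_group X\<^esub> v = v \<otimes>\<^bsub>free_group X\<^esub> u"
      using ij by (simp add: f.hom_mult[symmetric] del: f.hom_mult)
  qed
  have trivial: "K = {\<one>\<^bsub>G\<^esub>}" if K: "subgroup K G" "f ` K \<subseteq> {[]}" for K
  proof -
    have "k = \<one>\<^bsub>G\<^esub>" if "k \<in> K" for k
    proof (rule inj_onD[OF inj])
      show "f k = f \<one>\<^bsub>G\<^esub>"
        using that K(2) by (auto simp: one_free_group)
    qed (use that subgroup.mem_carrier[OF K(1)] in auto)
    then show ?thesis using subgroup.one_closed[OF K(1)] by blast
  qed
  show ?thesis
    using sub trivial[OF I.is_subgroup] trivial[OF J.is_subgroup]
    unfolding G_def[symmetric] by blast
qed


section \<open>The Top couple of free groups under the free group on two generators\<close>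

lemma cat_F2_simps:
  "objects cat_F2 = {L. is_F2_group L}" "grp cat_F2 = fst" "mor cat_F2 = F2_hom"
  by (simp_all add: cat_F2_def)

lemma is_group_category_cat_F2: "is_group_category (cat_F2 :: ('u F2_group, 'u) group_category)"
proof -
  have "g \<circ> f \<in> F2_hom L N" if "f \<in> F2_hom L M" "g \<in> F2_hom M N" for L M N :: "'u F2_group" and f g
    using that Group.hom_compose[of f "fst L" "fst M" g "fst N"] by (simp add: F2_hom_def)
  moreover have "(\<lambda>x. x) \<in> F2_hom L L" for L :: "'u F2_group"
    by (simp add: F2_hom_def hom_def)
  moreover have "F2_hom L M \<subseteq> hom (fst L) (fst M)" for L M :: "'u F2_group"
    by (auto simp: F2_hom_def)
  moreover have "group (fst L)" if "is_F2_group L" for L :: "'u F2_group"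
    using that by (simp add: is_F2_group_def)
  ultimately show ?thesis
    unfolding is_group_category_def cat_F2_simps by blast
qed

text \<open>The morphism followed by an isomorphism onto a group of reduced words is an embedding,
  to which \<open>nielsen_schreier\<close> applies.\<close>

lemma free_F2_groups_inj:
  fixes L :: "'v F2_group" and M :: "'u F2_group"
  assumes L: "is_F2_group L" and M: "M \<in> free_F2_groups"
    and f: "f \<in> F2_hom L M" "inj_on f (carrier (fst L))"
  shows "L \<in> free_F2_groups"
proof -
  have M': "is_free_group (fst M)" and hom: "f \<in> hom (fst L) (fst M)" and G: "group (fst L)"
    using L M f by (auto simp: free_F2_groups_def F2_hom_def is_F2_group_def)
  obtain X :: "'u set" and e where e: "e \<in> iso (fst M) (free_group X)"
    by (rule is_free_group_iso[OF M'])
  then have eh: "e \<in> hom (fst M) (free_group X)" and einj: "inj_on e (carrier (fst M))"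
    by (auto simp: iso_def bij_betw_def)
  have "inj_on (e \<circ> f) (carrier (fst L))"
    using f(2) inj_on_subset[OF einj] hom_carrier[OF hom] by (blast intro: comp_inj_on)
  then have "is_free_group (fst L)"
    using nielsen_schreier[OF G Group.hom_compose[OF hom eh]] by blast
  then show ?thesis using L by (simp add: free_F2_groups_def)
qed

text \<open>If \<open>snd L w\<close> lies in the preimage, then \<open>snd M w\<close> lies in
  \<open>I\<close> and is trivial, so \<open>w\<close> is trivial by injectivity of
  \<open>snd M\<close>.\<close>

lemma group_ideal_vimage_cat_F2:
  assumes L: "is_F2_group L" and M: "is_F2_group M" and f: "f \<in> F2_hom L M"
    and I: "group_ideal cat_F2 M I"
  shows "group_ideal cat_F2 L {x \<in> carrier (fst L). f x \<in> I}"
proof -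
  have N: "I \<lhd> fst M" and triv: "I \<inter> snd M ` carrier F2 = {\<one>\<^bsub>fst M\<^esub>}"
    using I group_ideal_cat_F2_iff[OF M] by auto
  interpret L: group "fst L" using L by (simp add: is_F2_group_def)
  interpret M: group "fst M" using M by (simp add: is_F2_group_def)
  interpret F: group F2 by (rule group_F2)
  interpret N: normal I "fst M" by (rule N)
  interpret f: group_hom "fst L" "fst M" f
    by unfold_locales (use f in \<open>simp add: F2_hom_def\<close>)
  interpret l: group_hom F2 "fst L" "snd L"
    by unfold_locales (use L in \<open>simp add: is_F2_group_def\<close>)
  interpret m: group_hom F2 "fst M" "snd M"
    by unfold_locales (use M in \<open>simp add: is_F2_group_def\<close>)
  have "{x \<in> carrier (fst L). f x \<in> I} \<lhd> fst L"
    unfolding L.normal_inv_iff by (auto intro!: L.subgroupI exI[of _ "\<one>\<^bsub>fst L\<^esub>"]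
        simp: N.inv_op_closed2)
  moreover have "x = \<one>\<^bsub>fst L\<^esub>" if x: "f x \<in> I" "x \<in> snd L ` carrier F2" for x
  proof -
    obtain w where w: "w \<in> carrier F2" "x = snd L w" using x by blast
    then have "snd M w = f x" using f by (simp add: F2_hom_def)
    then have "snd M w \<in> I \<inter> snd M ` carrier F2" using x w by (metis IntI imageI)
    then have "snd M w = snd M \<one>\<^bsub>F2\<^esub>" unfolding triv by simp
    then have "w = \<one>\<^bsub>F2\<^esub>"
      using M w F.one_closed unfolding is_F2_group_def by (blast dest: inj_onD)
    then show ?thesis using w by simp
  qed
  moreover have "f \<one>\<^bsub>fst L\<^esub> \<in> I"
    by simp
  moreover have "\<one>\<^bsub>fst L\<^esub> \<in> snd L ` carrier F2"
    using l.hom_one F.one_closed by (metis image_eqI)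
  ultimately show ?thesis
    unfolding group_ideal_cat_F2_iff[OF L] by blast
qed

theorem proposition3p4:
  shows "top_couple (cat_F2 :: ('u F2_group, 'u) group_category) free_F2_groups"
proof -
  have "free_F2_groups \<subseteq> {L. is_F2_group L}"
    by (auto simp: free_F2_groups_def)
  then show ?thesis
    unfolding top_couple_def cat_F2_simps mem_Collect_eq Ball_def
    by (intro conjI allI impI is_group_category_cat_F2)
      (blast intro: free_F2_groups_inj group_ideal_vimage_cat_F2
        dest: free_F2_group_commuting_normal)+
qed

end
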